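(* Fix $\beta>0$. Let $I\subseteq(0,\infty)$ be an interval and let $z:I\to\mathbb{R}$ be a continuous function such that, for every $\alpha\in I$, the point $z(\alpha)$ is a mode of the density $f_{\alpha,\beta}$. Then $z$ is an increasing function of $\alpha$ on $I$.
   Context: $\Phi$ and $\phi$ denote the standard normal cumulative distribution function and density, and $\mathrm{B}(\cdot,\cdot)$ is the beta function. For $\alpha,\beta>0$ the (standardized) beta normal density is $$f_{\alpha,\beta}(z)=\frac{1}{\mathrm{B}(\alpha,\beta)}\,\Phi(z)^{\alpha-1}\,[1-\Phi(z)]^{\beta-1}\,\phi(z),\qquad z\in\mathbb{R}.$$ A mode of $f_{\alpha,\beta}$ is a critical point $z$ (that is, $f_{\alpha,\beta}'(z)=0$) at which the second derivative is non-positive, $f_{\alpha,\beta}''(z)\le 0$. *)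

theory Defs
  imports "HOL-Probability.Probability"
begin

definition beta_normal_density :: "real \<Rightarrow> real \<Rightarrow> real \<Rightarrow> real" where
  "beta_normal_density \<alpha> \<beta> z =
     1 / Beta \<alpha> \<beta>
       * cdf std_normal_distribution z powr (\<alpha> - 1)
       * (1 - cdf std_normal_distribution z) powr (\<beta> - 1)
       * std_normal_density z"

(* A critical point with non-positive second derivative; this need not be a local maximum.
   Existence of both derivatives at z is part of the definition, so that deriv is not
   used at points where its value is arbitrary. *)
definition is_mode :: "(real \<Rightarrow> real) \<Rightarrow> real \<Rightarrow> bool" where
  "is_mode f z \<longleftrightarrow>
     (f has_real_derivative 0) (at z) \<and>
     (\<exists>D. (deriv f has_real_derivative D) (at z) \<and> D \<le> 0)"

end

theory Submission
  imports Defs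
begin

text \<open>
  Write \<open>\<Phi>\<close> and \<open>\<phi>\<close> for the standard normal distribution function and density. The logarithmic
  derivative of the beta normal density is affine in \<open>\<alpha>\<close>, with slope \<open>\<phi>/\<Phi> > 0\<close>:
  \<open>f'/f = (\<phi>/\<Phi>) (\<alpha> - A)\<close>, where the function \<open>A\<close> depends on the point and on \<open>\<beta>\<close> but not on \<open>\<alpha>\<close>.
  Hence a point \<open>x\<close> is critical for exactly one value of the parameter, namely \<open>\<alpha> = A(x)\<close>, and
  differentiating once more there gives \<open>f''(x) = - f(x) (\<phi>/\<Phi>)(x) A'(x)\<close>. So a mode satisfies
  \<open>\<alpha> = A(x)\<close> and \<open>A'(x) \<ge> 0\<close> (lemma \<open>is_mode_beta_normalD\<close>).

  The mode curve is thus a continuous right inverse of \<open>A\<close>. If \<open>a < b\<close> and \<open>z(b) \<le> z(a)\<close>, then by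
  the intermediate value theorem every point of \<open>[z(b), z(a)]\<close> is a mode for some parameter
  in \<open>[a, b]\<close>, so \<open>A' \<ge> 0\<close> on that interval and \<open>b = A(z(b)) \<le> A(z(a)) = a\<close>, a contradiction.
  Working with \<open>A\<close> itself, instead of solving for \<open>z\<close> by the implicit function theorem, also covers
  the degenerate modes with \<open>f'' = 0\<close>.
\<close>

abbreviation std_normal_cdf :: "real \<Rightarrow> real" where
  "std_normal_cdf \<equiv> cdf std_normal_distribution"

lemma std_normal_cdf_diff:
  assumes "a \<le> b"
  shows "std_normal_cdf b - std_normal_cdf a = integral {a..b} std_normal_density"
proof -
  interpret real_distribution std_normal_distribution
    by (rule real_dist_normal_dist)
  have int: "set_integrable lborel {a<..b} std_normal_density"
    unfolding set_integrable_def by (intro integrable_mult_indicator) auto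
  have "std_normal_cdf b - std_normal_cdf a = measure std_normal_distribution {a<..b}"
    using assms by (cases "a = b") (auto simp: cdf_diff_eq)
  also have "\<dots> = (LINT x|std_normal_distribution. indicator {a<..b} x)"
    by simp
  also have "\<dots> = (LINT x|lborel. std_normal_density x *\<^sub>R indicator {a<..b} x)"
    by (rule integral_density) auto
  also have "\<dots> = (LINT x:{a<..b}|lborel. std_normal_density x)"
    unfolding set_lebesgue_integral_def by (intro Bochner_Integration.integral_cong) auto
  also have "\<dots> = integral {a<..b} std_normal_density"
    by (rule set_borel_integral_eq_integral(2)[OF int])
  also have "\<dots> = integral {a..b} std_normal_density"
    by (rule integral_subset_negligible) (auto intro: negligible_subset[OF negligible_sing[of a]])
  finally show ?thesis .
qed

lemma has_real_derivative_std_normal_cdf: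
  "(std_normal_cdf has_real_derivative std_normal_density x) (at x)"
proof -
  have cont: "continuous_on {x - 1..x + 1} std_normal_density"
    unfolding normal_density_def by (intro continuous_intros) auto
  have "((\<lambda>u. integral {x - 1..u} std_normal_density) has_real_derivative std_normal_density x)
          (at x within {x - 1..x + 1})"
    by (rule integral_has_real_derivative[OF cont]) auto
  hence "((\<lambda>u. integral {x - 1..u} std_normal_density) has_real_derivative std_normal_density x) (at x)"
    by (subst (asm) at_within_Icc_at) auto
  hence "((\<lambda>u. std_normal_cdf (x - 1) + integral {x - 1..u} std_normal_density)
          has_real_derivative std_normal_density x) (at x)"
    by (auto intro!: derivative_eq_intros)
  thus ?thesis
    by (rule has_field_derivative_transform_within_open[where S = "{x - 1<..}"])
       (auto simp: std_normal_cdf_diff[symmetric])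
qed

lemma std_normal_cdf_strict_mono:
  assumes "a < b"
  shows "std_normal_cdf a < std_normal_cdf b"
  using assms
proof (rule DERIV_pos_imp_increasing)
  fix x
  show "\<exists>y. (std_normal_cdf has_real_derivative y) (at x) \<and> 0 < y"
    using has_real_derivative_std_normal_cdf[of x] normal_density_pos[of 1 0 x] by auto
qed

lemma std_normal_cdf_pos: "0 < std_normal_cdf x"
proof -
  have "0 \<le> std_normal_cdf (x - 1)"
    by (simp add: cdf_def)
  also have "\<dots> < std_normal_cdf x"
    by (rule std_normal_cdf_strict_mono) simp
  finally show ?thesis .
qed

lemma std_normal_cdf_less_1: "std_normal_cdf x < 1"
proof -
  interpret real_distribution std_normal_distribution
    by (rule real_dist_normal_dist)
  have "std_normal_cdf x < std_normal_cdf (x + 1)"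
    by (rule std_normal_cdf_strict_mono) simp
  also have "\<dots> \<le> 1"
    by (rule cdf_bounded_prob)
  finally show ?thesis .
qed

lemma has_real_derivative_std_normal_density:
  "(std_normal_density has_real_derivative - x * std_normal_density x) (at x)"
  unfolding normal_density_def by (rule derivative_eq_intros refl | simp)+

lemma has_real_derivative_powr_log:
  fixes g :: "real \<Rightarrow> real"
  assumes "(g has_real_derivative m) (at x)" "g x > 0"
  shows "((\<lambda>x. g x powr r) has_real_derivative g x powr r * (r * m / g x)) (at x)"
  using DERIV_fun_powr[OF assms, of r] assms(2) by (simp add: powr_diff mult_ac)

text \<open>
  The unique parameter for which a given point is critical, obtained by solving
  \<open>(\<alpha> - 1) \<phi>/\<Phi> - (\<beta> - 1) \<phi>/(1 - \<Phi>) - x = 0\<close> for \<open>\<alpha>\<close>.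
\<close>

definition critical_parameter :: "real \<Rightarrow> real \<Rightarrow> real" where
  "critical_parameter \<beta> x =
     1 + x * std_normal_cdf x / std_normal_density x
       + (\<beta> - 1) * std_normal_cdf x / (1 - std_normal_cdf x)"

lemma critical_parameter_differentiable:
  obtains d where "(critical_parameter \<beta> has_real_derivative d) (at x)"
proof -
  note derivs = has_real_derivative_std_normal_cdf has_real_derivative_std_normal_density
  have nz: "std_normal_density x \<noteq> 0" "1 - std_normal_cdf x \<noteq> 0"
    using normal_density_pos[of 1 0 x] std_normal_cdf_less_1[of x] by auto
  have "\<exists>d. (critical_parameter \<beta> has_real_derivative d) (at x)"
    unfolding critical_parameter_def [abs_def]
    by (rule exI) (rule derivative_intros derivs nz)+
  thus ?thesis using that by blast
qed

lemma beta_normal_density_pos: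
  assumes "\<alpha> > 0" "\<beta> > 0"
  shows "beta_normal_density \<alpha> \<beta> x > 0"
proof -
  have "Beta \<alpha> \<beta> > 0"
    using assms by (simp add: Beta_def)
  thus ?thesis
    using std_normal_cdf_pos[of x] std_normal_cdf_less_1[of x] normal_density_pos[of 1 0 x]
    by (simp add: beta_normal_density_def)
qed

lemma has_real_derivative_beta_normal_density:
  "(beta_normal_density \<alpha> \<beta> has_real_derivative
      beta_normal_density \<alpha> \<beta> x * (std_normal_density x / std_normal_cdf x)
        * (\<alpha> - critical_parameter \<beta> x)) (at x)"
proof -
  define c where "c = 1 / Beta \<alpha> \<beta>"
  define P where "P = std_normal_cdf x"
  define p where "p = std_normal_density x"
  have pos: "P > 0" "1 - P > 0" "p > 0"
    using std_normal_cdf_pos std_normal_cdf_less_1 normal_density_pos[of 1 0 x]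
    by (auto simp: P_def p_def)
  have 1: "((\<lambda>x. std_normal_cdf x powr (\<alpha> - 1)) has_real_derivative
             P powr (\<alpha> - 1) * ((\<alpha> - 1) * p / P)) (at x)"
    unfolding P_def p_def
    by (intro has_real_derivative_powr_log has_real_derivative_std_normal_cdf std_normal_cdf_pos)
  have 2: "((\<lambda>x. (1 - std_normal_cdf x) powr (\<beta> - 1)) has_real_derivative
             (1 - P) powr (\<beta> - 1) * ((\<beta> - 1) * (- p) / (1 - P))) (at x)"
    unfolding P_def p_def using std_normal_cdf_less_1[of x]
    by (intro has_real_derivative_powr_log)
       (auto intro!: derivative_eq_intros has_real_derivative_std_normal_cdf)
  have eq: "(\<alpha> - 1) * p / P + (\<beta> - 1) * (- p) / (1 - P) - x =
             p / P * (\<alpha> - critical_parameter \<beta> x)"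
    using pos unfolding critical_parameter_def P_def[symmetric] p_def[symmetric]
    by (simp add: divide_simps) (simp add: algebra_simps)
  have "((\<lambda>x. c * std_normal_cdf x powr (\<alpha> - 1) * (1 - std_normal_cdf x) powr (\<beta> - 1)
             * std_normal_density x) has_real_derivative
          c * P powr (\<alpha> - 1) * (1 - P) powr (\<beta> - 1) * p
            * ((\<alpha> - 1) * p / P + (\<beta> - 1) * (- p) / (1 - P) - x)) (at x)"
    by (rule derivative_eq_intros 1 2 has_real_derivative_std_normal_density refl)+
       (simp add: P_def[symmetric] p_def[symmetric], simp add: algebra_simps)
  from this[unfolded eq] show ?thesis
    unfolding beta_normal_density_def [abs_def] c_def P_def p_def by (simp add: mult.assoc)
qed

text \<open>
  At a critical point the factor \<open>\<alpha> - A\<close> of \<open>f'\<close> vanishes, so only its derivative \<open>- A'\<close> survives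
  in the product rule for \<open>f''\<close>; it is multiplied by the positive number \<open>f \<phi>/\<Phi>\<close>.
\<close>

lemma is_mode_beta_normalD:
  assumes "\<alpha> > 0" "\<beta> > 0" and mode: "is_mode (beta_normal_density \<alpha> \<beta>) x"
  shows "critical_parameter \<beta> x = \<alpha>"
    and "\<exists>d\<ge>0. (critical_parameter \<beta> has_real_derivative d) (at x)"
proof -
  define f where "f = beta_normal_density \<alpha> \<beta>"
  define k where "k = (\<lambda>x. f x * (std_normal_density x / std_normal_cdf x))"
  have k_pos: "k x > 0" for x
    using beta_normal_density_pos[OF assms(1,2), of x] std_normal_cdf_pos[of x]
      normal_density_pos[of 1 0 x] by (simp add: k_def f_def)
  have f': "(f has_real_derivative k y * (\<alpha> - critical_parameter \<beta> y)) (at y)" for y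
    unfolding f_def k_def by (rule has_real_derivative_beta_normal_density)
  have "k x * (\<alpha> - critical_parameter \<beta> x) = 0"
    using mode DERIV_unique[OF f'] unfolding is_mode_def f_def by blast
  with k_pos[of x] show crit: "critical_parameter \<beta> x = \<alpha>"
    by simp
  obtain d where d: "(critical_parameter \<beta> has_real_derivative d) (at x)"
    by (rule critical_parameter_differentiable)
  have nz: "std_normal_cdf x \<noteq> 0"
    using std_normal_cdf_pos[of x] by simp
  \<comment> \<open>In \<open>f''(x)\<close> the derivative of \<open>k\<close> is multiplied by \<open>\<alpha> - A(x) = 0\<close>, so its existence suffices.\<close>
  have "\<exists>k'. (k has_real_derivative k') (at x)"
    unfolding k_def
    by (rule exI) (rule derivative_intros f' has_real_derivative_std_normal_cdf
                     has_real_derivative_std_normal_density nz)+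
  then obtain k' where k': "(k has_real_derivative k') (at x)" ..
  have deriv_f: "deriv f = (\<lambda>y. k y * (\<alpha> - critical_parameter \<beta> y))"
    using f' by (intro ext DERIV_imp_deriv)
  have "(deriv f has_real_derivative - (k x * d)) (at x)"
    unfolding deriv_f by (rule derivative_eq_intros k' d refl)+ (simp add: crit)
  moreover obtain D where "(deriv f has_real_derivative D) (at x)" "D \<le> 0"
    using mode unfolding is_mode_def f_def by blast
  ultimately have "k x * d \<ge> 0"
    using DERIV_unique[of "deriv f" "- (k x * d)" x] by force
  hence "d \<ge> 0"
    using k_pos[of x] by (simp add: zero_le_mult_iff)
  with d show "\<exists>d\<ge>0. (critical_parameter \<beta> has_real_derivative d) (at x)"
    by blast
qed

theorem proposition1:
  fixes \<beta> :: real and I :: "real set" and z :: "real \<Rightarrow> real"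
  assumes "\<beta> > 0"
    and "is_interval I"
    and "I \<subseteq> {0<..}"
    and "continuous_on I z"
    and "\<And>\<alpha>. \<alpha> \<in> I \<Longrightarrow> is_mode (beta_normal_density \<alpha> \<beta>) (z \<alpha>)"
  shows "strict_mono_on I z"
proof (rule strict_mono_onI, rule ccontr)
  fix a b assume ab: "a \<in> I" "b \<in> I" "a < b" and "\<not> z a < z b"
  hence le: "z b \<le> z a" by simp
  have sub: "{a..b} \<subseteq> I"
    using ab assms(2) by (meson atLeastAtMost_iff mem_is_interval_1_I subsetI)
  have modeD: "critical_parameter \<beta> (z \<alpha>) = \<alpha>"
      "\<exists>d\<ge>0. (critical_parameter \<beta> has_real_derivative d) (at (z \<alpha>))" if "\<alpha> \<in> I" for \<alpha>
    using is_mode_beta_normalD[of \<alpha> \<beta> "z \<alpha>"] assms(1,3,5) that by auto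
  have "critical_parameter \<beta> (z b) \<le> critical_parameter \<beta> (z a)"
  proof (rule DERIV_nonneg_imp_nondecreasing[OF le])
    fix y assume "z b \<le> y" "y \<le> z a"
    then obtain \<alpha> where "a \<le> \<alpha>" "\<alpha> \<le> b" "z \<alpha> = y"
      using IVT2'[of z b y a] ab(3) continuous_on_subset[OF assms(4) sub] by auto
    moreover from this have "\<alpha> \<in> I"
      using sub by auto
    ultimately show "\<exists>d. (critical_parameter \<beta> has_real_derivative d) (at y) \<and> 0 \<le> d"
      using modeD(2)[of \<alpha>] by auto
  qed
  hence "b \<le> a"
    using modeD(1) ab by simp
  with ab show False by simp
qed

end
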